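(* Let $\{x_n\}_{n\in\mathbb{N}}$ be a strong divisibility sequence with $x_1=1$. Suppose that there exists $\alpha>0$ such that, for all but finitely many primes $p$, we have $m_p<p^{\alpha}$. Then there exist a constant $c>0$ and an integer $N_0$ (depending on the sequence and $\alpha$) such that for all integers $N\geq N_0$, $$\#\left\{n\leq N : \text{every prime } p\mid x_n \text{ satisfies } p>\tfrac12(\log N)(\log\log N)\right\}\geq c\,\frac{N}{\log\log N}.$$
   Context: $\mathbb{N}$ denotes the positive integers. A strong divisibility sequence (SDS) is a sequence of positive integers $\{x_n\}_{n\in\mathbb{N}}$ such that $\gcd(x_n,x_m)=x_{\gcd(n,m)}$ for all $m,n\geq 1$. For $d\in\mathbb{N}$, $m_d$ denotes the smallest positive integer such that $d\mid x_{m_d}$; if no such integer exists, $m_d=\infty$. In the counted set $n$ ranges over positive integers (and an $n$ with $x_n=1$ belongs to the set). *)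

theory Defs
  imports Complex_Main "HOL-Library.Extended_Real" "HOL-Computational_Algebra.Primes"
begin

text \<open>Sequences are indexed by the positive integers; the value \<open>x 0\<close> is never inspected.\<close>

definition strong_divisibility_sequence :: "(nat \<Rightarrow> nat) \<Rightarrow> bool" where
  "strong_divisibility_sequence x \<longleftrightarrow>
     (\<forall>n\<ge>1. x n > 0) \<and> (\<forall>m\<ge>1. \<forall>n\<ge>1. gcd (x n) (x m) = x (gcd n m))"

definition rank_of_apparition :: "(nat \<Rightarrow> nat) \<Rightarrow> nat \<Rightarrow> enat" where
  "rank_of_apparition x d =
     (if \<exists>m\<ge>1. d dvd x m then enat (LEAST m. m \<ge> 1 \<and> d dvd x m) else \<infinity>)"

end

theory Submission
  imports Defs "HOL-Analysis.Harmonic_Numbers" "HOL-Real_Asymp.Real_Asymp"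
begin

text \<open>
  If \<open>p\<close> divides \<open>x n\<close> then the rank of apparition \<open>m\<^sub>p\<close> divides \<open>n\<close>, hence so does any fixed prime
  factor \<open>q\<^sub>p\<close> of \<open>m\<^sub>p\<close>, which exists because \<open>x 1 = 1\<close> forces \<open>m\<^sub>p \<ge> 2\<close>. It therefore suffices to
  count the \<open>n \<le> N\<close> with no prime factor among the \<open>q\<^sub>p\<close>, \<open>p \<le> z = (1/2) ln N ln ln N\<close>. There are at
  most \<open>\<pi>(z)\<close> such primes, so the error term \<open>2\<^bsup>\<pi>(z)\<^esup>\<close> of Legendre's sieve is a power of \<open>N\<close> with
  exponent below 1 by Chebyshev's bound. For large \<open>N\<close> they are all at most \<open>z powr \<alpha>\<close>, so by the upper
  Mertens bound for \<open>\<Sum>1/p\<close> the main term is of order at least \<open>N / ln z\<close>.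
\<close>

section \<open>Legendre's sieve with an explicit error term\<close>

definition sifted :: "nat set \<Rightarrow> nat \<Rightarrow> nat set" where
  "sifted Q n = {k \<in> {1..n}. \<forall>q\<in>Q. \<not> q dvd k}"

lemma finite_sifted [simp]: "finite (sifted Q n)"
  by (simp add: sifted_def)

text \<open>The elements of \<open>sifted Q n\<close> that \<open>q\<close> divides are exactly the
  multiples \<open>q * k\<close> with \<open>k\<close> in \<open>sifted Q (n div q)\<close>: since
  \<open>q\<close> is a prime outside \<open>Q\<close>, cancelling it does not affect divisibility
  by any member of \<open>Q\<close>.\<close>

lemma card_sifted_insert:
  assumes "prime q" "q \<notin> Q" "\<And>p. p \<in> Q \<Longrightarrow> prime p"
  shows "card (sifted Q n) = card (sifted (insert q Q) n) + card (sifted Q (n div q))"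
proof -
  have q: "q > 0" using assms(1) prime_gt_0_nat by blast
  have *: "p dvd q * k \<longleftrightarrow> p dvd k" if "p \<in> Q" for p k
    using that assms by (metis prime_dvd_mult_iff primes_dvd_imp_eq)
  have le: "q * k \<le> n \<longleftrightarrow> k \<le> n div q" for k
    using q by (simp add: less_eq_div_iff_mult_less_eq mult.commute)
  have "{k \<in> sifted Q n. q dvd k} = (\<lambda>k. q * k) ` sifted Q (n div q)"
  proof (intro equalityI subsetI)
    fix k assume k: "k \<in> {k \<in> sifted Q n. q dvd k}"
    then obtain j where j: "k = q * j" by auto
    with k q have "j \<ge> 1" "j \<le> n div q"
      by (auto simp: sifted_def le Suc_le_eq)
    with k j show "k \<in> (\<lambda>k. q * k) ` sifted Q (n div q)"
      by (auto simp: sifted_def *)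
  next
    fix k assume "k \<in> (\<lambda>k. q * k) ` sifted Q (n div q)"
    then show "k \<in> {k \<in> sifted Q n. q dvd k}"
      using q by (auto simp: sifted_def * le Suc_le_eq)
  qed
  moreover have "card ((\<lambda>k. q * k) ` sifted Q (n div q)) = card (sifted Q (n div q))"
    using q by (intro card_image inj_onI) auto
  moreover have "sifted Q n = sifted (insert q Q) n \<union> {k \<in> sifted Q n. q dvd k}"
    by (auto simp: sifted_def)
  moreover have "sifted (insert q Q) n \<inter> {k \<in> sifted Q n. q dvd k} = {}"
    by (auto simp: sifted_def)
  ultimately show ?thesis
    by (metis card_Un_disjoint finite_sifted finite_Un)
qed

text \<open>Each new prime writes the count as a difference of two counts for the smaller set, at
  \<open>r\<close> and at \<open>r / q\<close>, so the error at most doubles. Letting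
  \<open>r\<close> be real makes the second count an instance of the induction hypothesis without
  further rounding.\<close>

lemma legendre_sieve:
  fixes r :: real
  assumes "finite Q" "\<And>q. q \<in> Q \<Longrightarrow> prime q" "r \<ge> 0"
  shows "\<bar>real (card (sifted Q (nat \<lfloor>r\<rfloor>))) - r * (\<Prod>q\<in>Q. 1 - 1 / real q)\<bar> \<le> 2 ^ card Q"
  using assms
proof (induction Q arbitrary: r rule: finite_induct)
  case empty
  have "sifted {} (nat \<lfloor>r\<rfloor>) = {1..nat \<lfloor>r\<rfloor>}" by (auto simp: sifted_def)
  moreover have "real (nat \<lfloor>r\<rfloor>) = of_int \<lfloor>r\<rfloor>" using empty by simp
  ultimately show ?case by simp linarith
next
  case (insert q Q)
  have q: "prime q" "q > 0" using insert.prems prime_gt_0_nat by auto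
  \<comment> \<open>Nested floors collapse, which turns the integer quotient of the recursion into
    the real quotient of the main term.\<close>
  have fl: "nat \<lfloor>r\<rfloor> div q = nat \<lfloor>r / real q\<rfloor>"
    using insert.prems(2) by (metis floor_divide_real_eq_div nat_div_distrib nat_int of_int_of_nat_eq of_nat_0_le_iff zero_le_floor)
  define P where "P = (\<Prod>q\<in>Q. 1 - 1 / real q)"
  have "card (sifted Q (nat \<lfloor>r\<rfloor>)) = card (sifted (insert q Q) (nat \<lfloor>r\<rfloor>)) + card (sifted Q (nat \<lfloor>r / real q\<rfloor>))"
    using card_sifted_insert[of q Q "nat \<lfloor>r\<rfloor>"] q insert fl by auto
  then have "real (card (sifted (insert q Q) (nat \<lfloor>r\<rfloor>))) - (r * P - r / real q * P) =
      (real (card (sifted Q (nat \<lfloor>r\<rfloor>))) - r * P) - (real (card (sifted Q (nat \<lfloor>r / real q\<rfloor>))) - r / real q * P)"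
    by simp
  moreover have "\<bar>real (card (sifted Q (nat \<lfloor>r\<rfloor>))) - r * P\<bar> \<le> 2 ^ card Q"
    unfolding P_def using insert.prems by (intro insert.IH) auto
  moreover have "\<bar>real (card (sifted Q (nat \<lfloor>r / real q\<rfloor>))) - r / real q * P\<bar> \<le> 2 ^ card Q"
    unfolding P_def using insert.prems q by (intro insert.IH) auto
  ultimately have "\<bar>real (card (sifted (insert q Q) (nat \<lfloor>r\<rfloor>))) - (r * P - r / real q * P)\<bar> \<le> 2 ^ card Q + 2 ^ card Q"
    by (simp only:) (rule order_trans[OF abs_triangle_ineq4 add_mono])
  moreover have "r * (\<Prod>q\<in>insert q Q. 1 - 1 / real q) = r * P - r / real q * P"
    using insert.hyps by (simp add: P_def algebra_simps)
  moreover have "(2::real) ^ card (insert q Q) = 2 ^ card Q + 2 ^ card Q"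
    using insert.hyps by simp
  ultimately show ?case by simp
qed

section \<open>Chebyshev's upper bounds for primes\<close>

abbreviation primes_le :: "nat \<Rightarrow> nat set" where
  "primes_le n \<equiv> {p. prime p \<and> p \<le> n}"

lemma finite_primes_le: "finite (primes_le n)"
  by (rule finite_subset[of _ "{..n}"]) auto

lemma primes_le_Suc: "primes_le (Suc n) = (if prime (Suc n) then insert (Suc n) (primes_le n) else primes_le n)"
  by (auto simp: le_Suc_eq)

lemma prod_primes_dvd:
  fixes n :: nat
  assumes "finite P" "\<And>p. p \<in> P \<Longrightarrow> prime p \<and> p dvd n"
  shows "\<Prod>P dvd n"
  using assms
proof (induction P rule: finite_induct)
  case (insert p P)
  have "coprime p (\<Prod>P)"
    using insert by (intro prod_coprime_right) (metis insertCI primes_coprime)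
  then show ?case using insert by (simp add: divides_mult)
qed auto

text \<open>Erdos's argument: an even \<open>n > 2\<close> adds no prime, and for
  \<open>n = 2 * m + 1\<close> the primes in \<open>(m + 1, n]\<close> all divide
  \<open>n choose m\<close>, which is at most \<open>4 ^ m\<close>; the primes up to
  \<open>m + 1\<close> fall under the induction hypothesis.\<close>

lemma primorial_le: "\<Prod>(primes_le n) \<le> 4 ^ n"
proof (induction n rule: less_induct)
  case (less n)
  consider "n \<le> 1" | "n = 2" | "n > 2" "even n" | m where "n = 2 * m + 1" "m \<ge> 1"
  proof (cases "n \<le> 2 \<or> even n")
    case True
    then show ?thesis using that(1-3) by linarith
  next
    case False
    then obtain m where m: "n = 2 * m + 1" by (meson oddE)
    with False have "m \<ge> 1" by simp
    with m that(4) show ?thesis by blast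
  qed
  then show ?case
  proof cases
    case 1
    then have "primes_le n = {}" by (auto dest!: prime_ge_2_nat)
    then show ?thesis by (simp only: prod.empty one_le_power one_le_numeral)
  next
    case 2
    then have "primes_le n = {2}" using prime_ge_2_nat by (auto intro: le_antisym)
    then show ?thesis using 2 by simp
  next
    case 3
    then obtain m where m: "n = Suc m" by (cases n) auto
    have "\<not> prime n" using 3 by (metis primes_dvd_imp_eq two_is_prime_nat less_irrefl)
    then have "primes_le n = primes_le m" using m primes_le_Suc by auto
    moreover have "\<Prod>(primes_le m) \<le> 4 ^ m" using less m by simp
    ultimately show ?thesis using m by (metis le_trans power_increasing one_le_numeral le_Suc_eq order_refl)
  next
    case (4 m)
    define P where "P = {p. prime p \<and> m + 1 < p \<and> p \<le> n}"
    have fP: "finite P" unfolding P_def by (rule finite_subset[of _ "{..n}"]) auto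
    have nm: "n - m = m + 1" using 4 by simp
    have "\<Prod>P dvd (n choose m)"
    proof (rule prod_primes_dvd[OF fP])
      fix p assume p: "p \<in> P"
      have "fact m * fact (n - m) * (n choose m) = fact n"
        using 4 by (intro binomial_fact_lemma) auto
      moreover have "p dvd fact n" using p by (auto simp: P_def prime_dvd_fact_iff)
      \<comment> \<open>Every prime in \<open>P\<close> exceeds \<open>m + 1 = n - m\<close>, so it
        divides \<open>fact n\<close> but neither factorial in the denominator.\<close>
      moreover have "\<not> p dvd fact m" "\<not> p dvd fact (n - m)"
        using p nm by (auto simp: P_def prime_dvd_fact_iff simp del: fact_Suc)
      ultimately have "p dvd (n choose m)" 
        using p by (metis (mono_tags, lifting) P_def mem_Collect_eq prime_dvd_mult_iff)
      then show "prime p \<and> p dvd (n choose m)" using p by (auto simp: P_def)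
    qed
    moreover have "n choose m > 0" using 4 by simp
    ultimately have P1: "\<Prod>P \<le> n choose m" by (simp add: dvd_imp_le)
    \<comment> \<open>The two central coefficients of an odd row are equal and together at most
      \<open>2 ^ n = 2 * 4 ^ m\<close>.\<close>
    have P2: "n choose m \<le> 4 ^ m"
    proof -
      have "(n choose m) + (n choose (m + 1)) = (\<Sum>k\<in>{m, m + 1}. n choose k)" by simp
      also have "\<dots> \<le> (\<Sum>k\<le>n. n choose k)" using 4 by (intro sum_mono2) auto
      also have "\<dots> = 2 ^ n" by (rule choose_row_sum)
      also have "\<dots> = 2 * 4 ^ m" using 4 by (simp add: power_mult power_add)
      finally have "(n choose m) + (n choose (m + 1)) \<le> 2 * 4 ^ m" .
      moreover have "(n choose (m + 1)) = (n choose m)" 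
        using binomial_symmetric[of "m+1" n] 4 by simp
      ultimately show ?thesis by linarith
    qed
    have "\<Prod>(primes_le n) = \<Prod>(primes_le (m + 1)) * \<Prod>P"
    proof -
      have "primes_le n = primes_le (m + 1) \<union> P" using 4 by (auto simp: P_def)
      moreover have "primes_le (m + 1) \<inter> P = {}" by (auto simp: P_def)
      ultimately show ?thesis by (simp only: prod.union_disjoint[OF finite_primes_le fP])
    qed
    also have "\<dots> \<le> 4 ^ (m + 1) * 4 ^ m"
    proof (rule mult_le_mono)
      show "\<Prod>(primes_le (m + 1)) \<le> 4 ^ (m + 1)" using 4 by (intro less) simp
      show "\<Prod>P \<le> 4 ^ m" using P1 P2 by (rule order_trans)
    qed
    also have "\<dots> = 4 ^ n" using 4 by (simp add: mult_2 power_add)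
    finally show ?thesis .
  qed
qed

lemma ln_prod_nat:
  fixes P :: "nat set"
  assumes "finite P" "\<And>p. p \<in> P \<Longrightarrow> p > 0"
  shows "ln (real (\<Prod>P)) = (\<Sum>p\<in>P. ln (real p))"
  using assms by (simp add: ln_prod)

lemma chebyshev_theta_le: "(\<Sum>p\<in>primes_le n. ln (real p)) \<le> real n * ln 4"
proof -
  have pos: "p > 0" if "p \<in> primes_le n" for p using that prime_gt_0_nat by blast
  have "(\<Sum>p\<in>primes_le n. ln (real p)) = ln (real (\<Prod>(primes_le n)))"
    using ln_prod_nat[OF finite_primes_le] pos by presburger
  also have "\<dots> \<le> ln (4 ^ n)"
  proof -
    have "0 < \<Prod>(primes_le n)" using pos by (intro prod_pos) auto
    then have "0 < real (\<Prod>(primes_le n))" by (simp only: of_nat_0_less_iff)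
    moreover have "real (\<Prod>(primes_le n)) \<le> real (4 ^ n)" using primorial_le by (rule of_nat_mono)
    ultimately show ?thesis by (simp only: of_nat_power of_nat_numeral ln_mono)
  qed
  also have "\<dots> = real n * ln 4" by (simp add: ln_realpow)
  finally show ?thesis .
qed

text \<open>Split at \<open>z powr (2/3)\<close>: smaller primes are counted trivially, and each
  larger one contributes at least \<open>2/3 * ln z\<close> to the Chebyshev sum, which is at most
  \<open>z * ln 4\<close>.\<close>

lemma card_primes_le_bound:
  assumes "z > 1"
  shows "real (card (primes_le (nat \<lfloor>z\<rfloor>))) \<le> z powr (2/3) + 3/2 * ln 4 * z / ln z"
proof -
  define P where "P = primes_le (nat \<lfloor>z\<rfloor>)"
  define L where "L = {p \<in> P. real p > z powr (2/3)}"
  have fin: "finite P" "finite L" using finite_primes_le by (auto simp: P_def L_def)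
  have "P \<subseteq> {1..nat \<lfloor>z powr (2/3)\<rfloor>} \<union> L"
  proof
    fix p assume p: "p \<in> P"
    then have "p \<ge> 1" using prime_ge_1_nat by (auto simp: P_def)
    then show "p \<in> {1..nat \<lfloor>z powr (2/3)\<rfloor>} \<union> L"
      using p le_nat_floor[of p "z powr (2/3)"] by (auto simp: L_def)
  qed
  then have "card P \<le> card ({1..nat \<lfloor>z powr (2/3)\<rfloor>} \<union> L)"
    using fin by (intro card_mono) auto
  also have "\<dots> \<le> nat \<lfloor>z powr (2/3)\<rfloor> + card L"
    using card_Un_le[of "{1..nat \<lfloor>z powr (2/3)\<rfloor>}" L] by simp
  finally have "real (card P) \<le> real (nat \<lfloor>z powr (2/3)\<rfloor>) + real (card L)" by linarith
  moreover have "real (nat \<lfloor>z powr (2/3)\<rfloor>) \<le> z powr (2/3)" by (simp add: of_nat_floor)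
  moreover have "real (card L) \<le> 3/2 * ln 4 * z / ln z"
  proof -
    have "real (card L) * (2/3 * ln z) = (\<Sum>p\<in>L. 2/3 * ln z)" by simp
    also have "\<dots> \<le> (\<Sum>p\<in>L. ln (real p))"
    proof (intro sum_mono)
      fix p assume "p \<in> L"
      then have "z powr (2/3) \<le> real p" by (simp add: L_def)
      then have "ln (z powr (2/3)) \<le> ln (real p)"
        using assms by (intro ln_mono) auto
      then show "2/3 * ln z \<le> ln (real p)" using assms by (simp add: ln_powr)
    qed
    also have "\<dots> \<le> (\<Sum>p\<in>P. ln (real p))"
      using fin prime_ge_1_nat by (intro sum_mono2) (auto simp: L_def P_def)
    also have "\<dots> \<le> real (nat \<lfloor>z\<rfloor>) * ln 4" unfolding P_def by (rule chebyshev_theta_le)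
    also have "\<dots> \<le> z * ln 4" using assms by (intro mult_right_mono) (auto simp: of_nat_floor)
    finally show ?thesis using assms by (simp add: field_simps)
  qed
  ultimately show ?thesis unfolding P_def by linarith
qed

section \<open>Mertens' estimates, in the directions the sieve needs\<close>

text \<open>\<open>n div p\<close> counts the multiples of \<open>p\<close> up to \<open>n\<close>.
  After exchanging the sums, each \<open>k\<close> carries the logarithm of the product of its
  distinct prime factors, which is at most \<open>ln k\<close>. Prime powers are ignored, hence an
  inequality.\<close>

lemma ln_fact_ge_sum_primes: "(\<Sum>p\<in>primes_le n. real (n div p) * ln (real p)) \<le> ln (fact n)"
proof -
  have card: "n div p = card {k \<in> {1..n}. p dvd k}" if "p > 0" for p
  proof -
    have "{k \<in> {1..n}. p dvd k} = (\<lambda>k. p * k) ` {1..n div p}"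
      using that by (auto simp: less_eq_div_iff_mult_less_eq mult.commute image_iff dvd_def Suc_le_eq) 
    then show ?thesis using that by (simp add: card_image inj_on_def)
  qed
  have "(\<Sum>p\<in>primes_le n. real (n div p) * ln (real p)) =
        (\<Sum>p\<in>primes_le n. \<Sum>k\<in>{k \<in> {1..n}. p dvd k}. ln (real p))"
    using prime_gt_0_nat by (intro sum.cong) (auto simp: card)
  also have "\<dots> = (\<Sum>k\<in>{1..n}. \<Sum>p\<in>{p \<in> primes_le n. p dvd k}. ln (real p))"
    by (rule sum.swap_restrict) (auto intro: finite_primes_le)
  also have "\<dots> \<le> (\<Sum>k\<in>{1..n}. ln (real k))"
  proof (intro sum_mono)
    fix k assume k: "k \<in> {1..n}"
    let ?P = "{p \<in> primes_le n. p dvd k}"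
    have fin: "finite ?P" using finite_primes_le by simp
    have pos: "p > 0" if "p \<in> ?P" for p using that prime_gt_0_nat by blast
    have "\<Prod>?P dvd k" by (rule prod_primes_dvd[OF fin]) auto
    then have "\<Prod>?P \<le> k" using k by (intro dvd_imp_le) auto
    moreover have "\<Prod>?P > 0" using pos by (intro prod_pos) auto
    ultimately have "ln (real (\<Prod>?P)) \<le> ln (real k)" by (intro ln_mono) (simp_all only: of_nat_le_iff of_nat_0_less_iff)
    then show "(\<Sum>p\<in>?P. ln (real p)) \<le> ln (real k)" using ln_prod_nat[OF fin pos] by simp
  qed
  also have "\<dots> = ln (fact n)" 
    using ln_prod_nat[of "{1..n}"] by (simp add: fact_prod)
  finally show ?thesis .
qed

text \<open>Replacing \<open>n / p\<close> by \<open>n div p\<close> costs at most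
  \<open>ln p\<close> per prime, in total at most \<open>n * ln 4\<close> by Chebyshev; the rest is
  bounded by \<open>ln (fact n) \<le> n * ln n\<close>.\<close>

lemma mertens_first_le:
  assumes "n \<ge> 1"
  shows "(\<Sum>p\<in>primes_le n. ln (real p) / real p) \<le> ln (real n) + 2"
proof -
  have "real n * (\<Sum>p\<in>primes_le n. ln (real p) / real p) = (\<Sum>p\<in>primes_le n. real n / real p * ln (real p))"
    by (simp add: sum_distrib_left)
  also have "\<dots> \<le> (\<Sum>p\<in>primes_le n. real (n div p) * ln (real p) + ln (real p))"
  proof (intro sum_mono)
    fix p assume p: "p \<in> primes_le n"
    have "real n / real p \<le> real (n div p) + 1"
    proof -
      have "\<lfloor>real n / real p\<rfloor> = int (n div p)" by (rule floor_divide_of_nat_eq)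
      then show ?thesis by linarith
    qed
    moreover have "ln (real p) \<ge> 0" using p prime_ge_1_nat by auto
    ultimately have "real n / real p * ln (real p) \<le> (real (n div p) + 1) * ln (real p)"
      by (rule mult_right_mono)
    then show "real n / real p * ln (real p) \<le> real (n div p) * ln (real p) + ln (real p)"
      by (simp add: algebra_simps)
  qed
  also have "\<dots> \<le> ln (fact n) + real n * ln 4"
    using ln_fact_ge_sum_primes[of n] chebyshev_theta_le[of n] by (simp add: sum.distrib)
  also have "\<dots> \<le> real n * ln (real n) + real n * 2"
  proof -
    have "ln (fact n) \<le> ln (real n ^ n)"
      using fact_le_power[where ?'a = real, of n] assms by (intro ln_mono) auto
    then have "ln (fact n) \<le> real n * ln (real n)" using assms by (simp add: ln_realpow)
    moreover have "ln (4::real) \<le> 2"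
      using ln_2_less_1 ln_realpow[of 2 2] by simp
    ultimately show ?thesis by (intro add_mono mult_left_mono) auto
  qed
  also have "\<dots> = real n * (ln (real n) + 2)" by (simp add: algebra_simps)
  finally show ?thesis using assms by (simp add: mult_le_cancel_left)
qed

text \<open>This form of partial summation is inductive: only the upper bound \<open>mertens_first_le\<close> at \<open>n\<close> enters the step.\<close>

lemma sum_inverse_primes_aux:
  assumes "n \<ge> 2"
  shows "(\<Sum>p\<in>primes_le n. 1 / real p) \<le> (\<Sum>p\<in>primes_le n. ln (real p) / real p) / ln (real n)
           + ln (ln (real n)) - ln (ln 2) + 2 * (1 / ln 2 - 1 / ln (real n))"
  using assms
proof (induction n rule: dec_induct)
  case base
  have "primes_le 2 = {2}" using prime_ge_2_nat by (auto intro: le_antisym)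
  then show ?case by simp
next
  case (step n)
  define A where "A = (\<Sum>p\<in>primes_le n. ln (real p) / real p)"
  define s where "s = (\<Sum>p\<in>primes_le n. 1 / real p)"
  define u where "u = (if prime (Suc n) then 1 / real (Suc n) else 0)"
  define a where "a = ln (real n)"
  define b where "b = ln (real (Suc n))"
  have ab: "0 < a" "a < b" using step by (auto simp: a_def b_def)
  have "(\<Sum>p\<in>primes_le (Suc n). ln (real p) / real p) = A + u * b"
    using finite_primes_le[of n] by (auto simp: A_def u_def b_def primes_le_Suc)
  moreover have "(\<Sum>p\<in>primes_le (Suc n). 1 / real p) = s + u"
    using finite_primes_le[of n] by (auto simp: s_def u_def primes_le_Suc)
  moreover have "s \<le> A / a + ln a - ln (ln 2) + 2 * (1 / ln 2 - 1 / a)"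
    using step by (simp add: A_def s_def a_def)
  moreover have "A / a + u + ln a - 2 / a \<le> (A + u * b) / b + ln b - 2 / b"
  proof -
    have "A \<le> a + 2" unfolding A_def a_def using step by (intro mertens_first_le) auto
    then have "A * (1 / a - 1 / b) \<le> (a + 2) * (1 / a - 1 / b)"
      using ab by (intro mult_right_mono) (auto simp: field_simps)
    \<comment> \<open>With \<open>t = a / b\<close>, the inequality \<open>ln t \<le> t - 1\<close>
      lets the increment of \<open>ln (ln n)\<close> absorb \<open>1 - a / b\<close>, while the
      terms \<open>2 / a - 2 / b\<close> telescope.\<close>
    moreover have "ln (a / b) \<le> a / b - 1" using ab by (intro ln_le_minus_one) auto
    then have "1 - a / b \<le> ln b - ln a" using ab by (simp add: ln_div)
    moreover have "(a + 2) * (1 / a - 1 / b) = 1 - a / b + 2 / a - 2 / b"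
      using ab by (simp add: field_simps)
    moreover have "A * (1 / a - 1 / b) = A / a - A / b" by (simp add: algebra_simps)
    moreover have "(A + u * b) / b = A / b + u" using ab by (simp add: field_simps)
    ultimately show ?thesis by linarith
  qed
  ultimately show ?case unfolding b_def[symmetric] by (simp add: algebra_simps) 
qed

lemma sum_inverse_primes_le:
  assumes "n \<ge> 2"
  shows "(\<Sum>p\<in>primes_le n. 1 / real p) \<le> ln (ln (real n)) + (1 + 2 / ln 2 - ln (ln 2))"
proof -
  have n: "ln (real n) > 0" using assms by auto
  have "(\<Sum>p\<in>primes_le n. ln (real p) / real p) / ln (real n) \<le> (ln (real n) + 2) / ln (real n)"
    using n assms by (intro divide_right_mono mertens_first_le) auto
  also have "\<dots> = 1 + 2 / ln (real n)" using n by (simp add: field_simps)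
  finally show ?thesis using sum_inverse_primes_aux[OF assms] by (simp add: algebra_simps)
qed

lemma sum_inverse_squares_le: "(\<Sum>k\<in>{2..Suc n}. 1 / real k ^ 2) \<le> 1 - 1 / real (Suc n)"
proof (induction n)
  case (Suc n)
  have "1 / real (Suc (Suc n)) ^ 2 \<le> 1 / real (Suc n) - 1 / real (Suc (Suc n))"
  proof -
    have "1 / real (Suc (Suc n)) ^ 2 \<le> 1 / (real (Suc n) * real (Suc (Suc n)))"
      unfolding power2_eq_square by (intro divide_left_mono mult_right_mono) auto
    also have "\<dots> = 1 / real (Suc n) - 1 / real (Suc (Suc n))" by (simp add: field_simps)
    finally show ?thesis .
  qed
  then show ?case using Suc by simp
qed simp

text \<open>For \<open>0 \<le> t \<le> 1/2\<close> one has
  \<open>ln (1 - t) \<ge> - t - 2 * t ^ 2\<close>. With \<open>t = 1 / p\<close> the linear terms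
  sum to at most \<open>ln (ln n) + C\<close>, and the inverse squares to at most 1, so the
  quadratic terms cost at most 2.\<close>

lemma mertens_product_ge:
  obtains c :: real where "c > 0"
    "\<And>n. n \<ge> 2 \<Longrightarrow> (\<Prod>p\<in>primes_le n. 1 - 1 / real p) \<ge> c / ln (real n)"
proof
  define C :: real where "C = 1 + 2 / ln 2 - ln (ln 2)"
  show "exp (- C - 2) > 0" by simp
  fix n :: nat assume n: "n \<ge> 2"
  have p2: "p \<ge> 2" if "p \<in> primes_le n" for p using that prime_ge_2_nat by auto
  have "(\<Sum>p\<in>primes_le n. 1 / real p ^ 2) \<le> (\<Sum>k\<in>{2..Suc n}. 1 / real k ^ 2)"
    using p2 by (intro sum_mono2) auto
  also have "\<dots> \<le> 1" using sum_inverse_squares_le[of n] by (simp add: order_trans)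
  finally have sq: "(\<Sum>p\<in>primes_le n. 1 / real p ^ 2) \<le> 1" .
  have "exp (- C - 2) / ln (real n) = exp (- C - 2 - ln (ln (real n)))"
    using n by (simp add: exp_diff)
  also have "\<dots> \<le> exp (- (\<Sum>p\<in>primes_le n. 1 / real p) - 2 * (\<Sum>p\<in>primes_le n. 1 / real p ^ 2))"
    using sum_inverse_primes_le[OF n] sq by (simp add: C_def)
  also have "\<dots> = exp (\<Sum>p\<in>primes_le n. - (1 / real p) - 2 * (1 / real p) ^ 2)"
    by (simp add: sum_subtractf sum_negf sum_distrib_left power_one_over)
  also have "\<dots> = (\<Prod>p\<in>primes_le n. exp (- (1 / real p) - 2 * (1 / real p) ^ 2))"
    by (rule exp_sum[OF finite_primes_le])
  also have "\<dots> \<le> (\<Prod>p\<in>primes_le n. 1 - 1 / real p)"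
  proof (intro prod_mono conjI)
    fix p assume "p \<in> primes_le n"
    then have p: "real p \<ge> 2" using p2 by simp
    then have "- (1 / real p) - 2 * (1 / real p) ^ 2 \<le> ln (1 - 1 / real p)"
      by (intro ln_one_minus_pos_lower_bound) (auto simp: field_simps)
    then have "exp (- (1 / real p) - 2 * (1 / real p) ^ 2) \<le> exp (ln (1 - 1 / real p))" by simp
    then show "exp (- (1 / real p) - 2 * (1 / real p) ^ 2) \<le> 1 - 1 / real p" using p by simp
  qed auto
  finally show "exp (- C - 2) / ln (real n) \<le> (\<Prod>p\<in>primes_le n. 1 - 1 / real p)" .
qed

section \<open>Ranks of apparition and the choice of sieving primes\<close>

text \<open>Strong divisibility gives \<open>p dvd x (gcd n m)\<close> for the rank
  \<open>m\<close>, and minimality of \<open>m\<close> forces \<open>gcd n m = m\<close>. Rank 1 is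
  excluded by \<open>x 1 = 1\<close>.\<close>

lemma rank_of_apparition_dvd:
  assumes "strong_divisibility_sequence x" "x 1 = 1" "prime p" "p dvd x n" "n \<ge> 1"
  obtains m where "rank_of_apparition x p = enat m" "m \<ge> 2" "m dvd n"
proof
  define m where "m = (LEAST m. m \<ge> 1 \<and> p dvd x m)"
  show "rank_of_apparition x p = enat m"
    using assms unfolding rank_of_apparition_def m_def by auto
  have m: "m \<ge> 1 \<and> p dvd x m"
    unfolding m_def by (rule LeastI[of _ n]) (use assms in auto)
  have "m \<noteq> 1" using m assms(2,3) by auto
  then show "m \<ge> 2" using m by simp
  have "gcd (x n) (x m) = x (gcd n m)"
    using assms(1,5) m by (simp add: strong_divisibility_sequence_def)
  then have "p dvd x (gcd n m)" using assms(4) m by (metis gcd_greatest)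
  then have "m \<le> gcd n m" 
    unfolding m_def by (intro Least_le) (use m assms(5) in \<open>auto simp: Suc_le_eq\<close>)
  then have "gcd n m = m" using m gcd_le2_nat[of m n] by (intro le_antisym) auto
  then show "m dvd n" by (metis gcd_dvd1)
qed

lemma sieving_prime_exists:
  assumes "strong_divisibility_sequence x" "x 1 = 1" "prime p" "p dvd x k" "k \<ge> 1"
  shows "\<exists>q. prime q \<and> enat q \<le> rank_of_apparition x p \<and> (\<forall>n\<ge>1. p dvd x n \<longrightarrow> q dvd n)"
proof -
  obtain m where m: "rank_of_apparition x p = enat m" "m \<ge> 2"
    using rank_of_apparition_dvd[OF assms] by metis
  obtain q where q: "prime q" "q dvd m" using m(2) prime_factor_nat[of m] by auto
  have "q dvd n" if "n \<ge> 1" "p dvd x n" for n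
    using rank_of_apparition_dvd[OF assms(1-3) that(2,1)] m q by (metis dvd_trans enat.inject)
  moreover have "q \<le> m" using q(2) m(2) by (intro dvd_imp_le) auto
  ultimately show ?thesis using q m by auto
qed

section \<open>Assembling the lower bound\<close>

text \<open>Enlarging \<open>Q\<close> to all primes up to \<open>Y\<close> only multiplies the
  product by factors in \<open>[0, 1]\<close>, so Mertens' bound applies to any \<open>Q\<close>.
  The main term sees only the size bound \<open>Y\<close>, the error only the cardinality bound
  \<open>k\<close>.\<close>

lemma card_sifted_ge:
  fixes n :: nat
  assumes c: "c > 0" "\<And>n. n \<ge> 2 \<Longrightarrow> (\<Prod>p\<in>primes_le n. 1 - 1 / real p) \<ge> c / ln (real n)"
    and Q: "Q \<subseteq> primes_le Y" "Y \<ge> 2" "card Q \<le> k"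
  shows "real (card (sifted Q n)) \<ge> c * real n / ln (real Y) - 2 ^ k"
proof -
  have fin: "finite Q" using Q(1) finite_primes_le by (rule finite_subset)
  have "\<bar>real (card (sifted Q n)) - real n * (\<Prod>q\<in>Q. 1 - 1 / real q)\<bar> \<le> 2 ^ card Q"
    using legendre_sieve[OF fin, of "real n"] Q by auto
  moreover have "(2::real) ^ card Q \<le> 2 ^ k" using Q(3) by (intro power_increasing) auto
  moreover have "c / ln (real Y) \<le> (\<Prod>q\<in>Q. 1 - 1 / real q)"
  proof -
    have le1: "1 / real q \<le> 1" if "prime q" for q :: nat
      using prime_ge_1_nat[OF that] by simp
    have "(\<Prod>q\<in>primes_le Y. 1 - 1 / real q) \<le> (\<Prod>q\<in>Q. 1 - 1 / real q)"
      unfolding prod.subset_diff[OF Q(1) finite_primes_le]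
      using Q(1) by (intro mult_left_le_one_le prod_le_1 prod_nonneg) (auto intro!: le1)
    then show ?thesis using c(2)[OF Q(2)] by linarith
  qed
  then have "c / ln (real Y) * real n \<le> (\<Prod>q\<in>Q. 1 - 1 / real q) * real n"
    by (intro mult_right_mono) auto
  then have "c * real n / ln (real Y) \<le> real n * (\<Prod>q\<in>Q. 1 - 1 / real q)"
    by (simp add: mult.commute)
  ultimately show ?thesis by linarith
qed

text \<open>The bound \<open>ln 2 \<le> 25/36\<close> makes the constants rational. For
  \<open>z = 1/2 * ln N * ln (ln N)\<close> the quotient \<open>z / ln z\<close> is asymptotic to
  \<open>ln N / 2\<close>, so the exponent is asymptotic to \<open>625/864 * ln N\<close> and the
  error is a power of \<open>N\<close> below the first.\<close>

lemma two_power_primes_le_bound: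
  fixes z :: real
  assumes "z > 1"
  shows "2 ^ card (primes_le (nat \<lfloor>z\<rfloor>)) \<le> exp (25/36 * (z powr (2/3) + 25/12 * z / ln z))"
proof -
  have l2: "ln (2::real) \<le> 25/36" by (rule ln2_le_25_over_36)
  have "ln (4::real) = 2 * ln 2" using ln_realpow[of 2 2] by simp
  then have "3/2 * ln 4 \<le> (25/12 :: real)" using l2 by simp
  moreover have "z / ln z \<ge> 0" using assms by simp
  ultimately have "3/2 * ln 4 * (z / ln z) \<le> 25/12 * (z / ln z)"
    by (rule mult_right_mono)
  then have k: "real (card (primes_le (nat \<lfloor>z\<rfloor>))) \<le> z powr (2/3) + 25/12 * z / ln z"
    using card_primes_le_bound[OF assms] by simp
  have "(2::real) ^ card (primes_le (nat \<lfloor>z\<rfloor>)) = exp (ln 2 * real (card (primes_le (nat \<lfloor>z\<rfloor>))))"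
    by (simp add: exp_of_nat2_mult)
  also have "\<dots> \<le> exp (25/36 * (z powr (2/3) + 25/12 * z / ln z))"
    unfolding exp_le_cancel_iff using k l2 by (intro mult_mono) auto
  finally show ?thesis .
qed

theorem theorem1p2:
  fixes x :: "nat \<Rightarrow> nat" and \<alpha> :: real
  assumes "strong_divisibility_sequence x"
    and "x 1 = 1"
    and "\<alpha> > 0"
    and "finite {p. prime p \<and> \<not> ereal_of_enat (rank_of_apparition x p) < ereal (real p powr \<alpha>)}"
  shows "\<exists>c::real. c > 0 \<and> (\<exists>N0::nat. \<forall>N\<ge>N0.
           real (card {n. 1 \<le> n \<and> n \<le> N \<and>
             (\<forall>p. prime p \<and> p dvd x n \<longrightarrow> real p > 1 / 2 * ln (real N) * ln (ln (real N)))})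
           \<ge> c * (real N / ln (ln (real N))))"
proof -
  define F where "F = {p. prime p \<and> \<not> ereal_of_enat (rank_of_apparition x p) < ereal (real p powr \<alpha>)}"
  \<comment> \<open>A prime outside \<open>D\<close> divides no term of the sequence and imposes no
    condition, so only primes in \<open>D\<close> need a sieving prime.\<close>
  define D where "D = {p. prime p \<and> (\<exists>k\<ge>1. p dvd x k)}"
  have "\<forall>p\<in>D. \<exists>q. prime q \<and> enat q \<le> rank_of_apparition x p \<and> (\<forall>n\<ge>1. p dvd x n \<longrightarrow> q dvd n)"
    unfolding D_def using sieving_prime_exists[OF assms(1,2)] by blast
  then obtain g where g: "\<And>p. p \<in> D \<Longrightarrow> prime (g p)"
      "\<And>p. p \<in> D \<Longrightarrow> enat (g p) \<le> rank_of_apparition x p"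
      "\<And>p n. p \<in> D \<Longrightarrow> n \<ge> 1 \<Longrightarrow> p dvd x n \<Longrightarrow> g p dvd n"
    by (metis bchoice)
  have g_less: "real (g p) < real p powr \<alpha>" if "p \<in> D" "p \<notin> F" for p
  proof -
    have "ereal_of_enat (enat (g p)) \<le> ereal_of_enat (rank_of_apparition x p)"
      using g(2)[OF that(1)] by (simp only: ereal_of_enat_le_iff)
    also have "\<dots> < ereal (real p powr \<alpha>)" using that by (auto simp: F_def D_def)
    finally show ?thesis by simp
  qed
  have "finite F" unfolding F_def by (rule assms(4))
  then have M: "g p \<le> Max (g ` F)" if "p \<in> F" for p
    using that by simp
  \<comment> \<open>Off \<open>D\<close> the values of \<open>g\<close> are arbitrary, and so is
    \<open>M\<close> if \<open>F\<close> is empty; all that matters is a number independent of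
    \<open>N\<close> that bounds \<open>g\<close> on \<open>F\<close>.\<close>
  define M where "M = Max (g ` F)"
  obtain c :: real where c: "c > 0" 
    "\<And>n. n \<ge> 2 \<Longrightarrow> (\<Prod>p\<in>primes_le n. 1 - 1 / real p) \<ge> c / ln (real n)"
    using mertens_product_ge by blast
  \<comment> \<open>The main term will be at least
    \<open>c * N / (2 * \<alpha> * ln (ln N))\<close>, which is twice the target
    \<open>d * N / ln (ln N)\<close>; the spare half pays for the sieve error.\<close>
  define d where "d = c / (4 * \<alpha>)"
  have d: "d > 0" using c assms(3) by (simp add: d_def)
  define z where "z = (\<lambda>N::nat. 1 / 2 * ln (real N) * ln (ln (real N)))"
  have "eventually (\<lambda>N. real (card {n. 1 \<le> n \<and> n \<le> N \<and>
             (\<forall>p. prime p \<and> p dvd x n \<longrightarrow> real p > z N)}) \<ge> d * (real N / ln (ln (real N)))) sequentially"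
  proof -
    have ev_z: "eventually (\<lambda>N. z N > 1) sequentially"
      unfolding z_def by real_asymp
    have "filterlim (\<lambda>N. z N powr \<alpha>) at_top sequentially"
      unfolding z_def using assms(3) by real_asymp
    \<comment> \<open>Once \<open>z N powr \<alpha>\<close> exceeds \<open>M\<close>, the sieving
      primes of the exceptional primes in \<open>F\<close> obey the same bound as all
      others.\<close>
    then have ev_Y: "eventually (\<lambda>N. z N powr \<alpha> \<ge> real (max 2 M)) sequentially"
      unfolding filterlim_at_top by blast
    \<comment> \<open>In fact \<open>ln (z N)\<close> is asymptotic to \<open>ln (ln N)\<close>; the
      factor 2 is slack.\<close>
    have ev_ln: "eventually (\<lambda>N. ln (z N) \<le> 2 * ln (ln (real N))) sequentially"
      unfolding z_def by real_asymp
    have ev_err: "eventually (\<lambda>N. exp (25/36 * (z N powr (2/3) + 25/12 * z N / ln (z N)))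
        \<le> d * (real N / ln (ln (real N)))) sequentially"
      unfolding z_def using d by real_asymp
    show ?thesis using ev_z ev_Y ev_ln ev_err
    proof eventually_elim
      case (elim N)
      define Y where "Y = nat \<lfloor>z N powr \<alpha>\<rfloor>"
      define R where "R = {p \<in> D. real p \<le> z N}"
      have R: "R \<subseteq> primes_le (nat \<lfloor>z N\<rfloor>)"
        by (auto simp: R_def D_def intro: le_nat_floor)
      then have finR: "finite R" using finite_primes_le by (rule finite_subset)
      have Y2: "Y \<ge> 2" unfolding Y_def using elim(2) by (intro le_nat_floor) auto
      have gY: "g ` R \<subseteq> primes_le Y"
      proof (intro image_subsetI CollectI conjI)
        fix p assume p: "p \<in> R"
        then show "prime (g p)" using g(1) by (auto simp: R_def)
        have "real (g p) \<le> z N powr \<alpha>"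
        proof (cases "p \<in> F")
          case True
          then have "real (g p) \<le> real (max 2 M)" using M[of p] by (simp add: M_def)
          then show ?thesis using elim(2) by linarith
        next
          case False
          have "real p powr \<alpha> \<le> z N powr \<alpha>"
            using p assms(3) by (intro powr_mono2) (auto simp: R_def)
          then show ?thesis using g_less[of p] False p by (auto simp: R_def)
        qed
        then show "g p \<le> Y" unfolding Y_def by (rule le_nat_floor)
      qed
      \<comment> \<open>Different primes may share a sieving prime, but this only lowers the number
        of primes sieved by.\<close>
      have "card (g ` R) \<le> card (primes_le (nat \<lfloor>z N\<rfloor>))"
        using card_image_le[OF finR, of g] card_mono[OF finite_primes_le R] by linarith
      then have S: "c * real N / ln (real Y) - 2 ^ card (primes_le (nat \<lfloor>z N\<rfloor>)) \<le> real (card (sifted (g ` R) N))"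
        by (intro card_sifted_ge[OF c gY Y2])
      have "ln (real Y) \<le> \<alpha> * ln (z N)"
      proof -
        have "real Y \<le> z N powr \<alpha>" unfolding Y_def by (rule of_nat_floor) simp
        then have "ln (real Y) \<le> ln (z N powr \<alpha>)" using Y2 by (intro ln_mono) auto
        then show ?thesis using elim(1) by (simp add: ln_powr)
      qed
      also have "\<dots> \<le> \<alpha> * (2 * ln (ln (real N)))"
        using elim(3) assms(3) by (intro mult_left_mono) auto
      finally have lnY: "ln (real Y) \<le> \<alpha> * (2 * ln (ln (real N)))" .
      have "c * real N / (\<alpha> * (2 * ln (ln (real N)))) \<le> c * real N / ln (real Y)"
      proof (rule divide_left_mono[OF lnY])
        show "0 < \<alpha> * (2 * ln (ln (real N))) * ln (real Y)"
        proof -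
          have "ln (real Y) > 0" using Y2 by auto
          then show ?thesis using lnY by (intro mult_pos_pos[of "\<alpha> * _"]) auto
        qed
      qed (use c in auto)
      moreover have "c * real N / (\<alpha> * (2 * ln (ln (real N)))) = 2 * (d * (real N / ln (ln (real N))))"
        using assms(3) by (simp add: d_def field_simps)
      ultimately have "d * (real N / ln (ln (real N))) \<le> real (card (sifted (g ` R) N))"
        using S two_power_primes_le_bound[OF elim(1)] elim(4) by linarith
      also have "card (sifted (g ` R) N) \<le> card {n. 1 \<le> n \<and> n \<le> N \<and>
             (\<forall>p. prime p \<and> p dvd x n \<longrightarrow> real p > z N)}"
      proof (rule card_mono)
        show "sifted (g ` R) N \<subseteq> {n. 1 \<le> n \<and> n \<le> N \<and>
             (\<forall>p. prime p \<and> p dvd x n \<longrightarrow> real p > z N)}"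
        proof (intro subsetI CollectI conjI allI impI)
          fix n p assume n: "n \<in> sifted (g ` R) N" and p: "prime p \<and> p dvd x n"
          have n1: "n \<ge> 1" using n by (simp add: sifted_def)
          show "real p > z N"
          proof (rule ccontr)
            assume "\<not> real p > z N"
            then have pR: "p \<in> R" "p \<in> D" using p n1 by (auto simp: R_def D_def)
            then have "g p dvd n" using g(3) n1 p by blast
            then show False using n pR(1) by (auto simp: sifted_def)
          qed
        qed (auto simp: sifted_def)
      qed (auto intro: finite_subset[of _ "{..N}"])
      finally show ?case by simp
    qed
  qed
  then show ?thesis unfolding z_def eventually_sequentially using d by blast
qed

end
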